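(* Let $G$ be a graph on $n\geqslant 6$ vertices with $\mu(G)>n-2$. If $n=6$, then $G$ contains $P_6^2$ as a subgraph unless $G$ is a subgraph of $K_6-E(S_5)$ or of $K_6-E(K_3)$. If $n\geqslant 7$, then $G$ contains $P_n^2$ as a subgraph unless $G$ is a subgraph of $K_n-E(S_{n-1})$.
   Context: All graphs are finite and simple. $\mu(G)$ denotes the spectral radius (largest eigenvalue of the adjacency matrix) of $G$. $P_n$, $K_n$, $S_n$ denote the path, complete graph and star on $n$ vertices (so $S_{n-1}$ has a center of degree $n-2$). $P_n^2$ is the square of $P_n$: same vertex set, two vertices adjacent iff their distance in $P_n$ is at most two. For a graph $H$ with at most $n$ vertices, $K_n-E(H)$ denotes the graph obtained from $K_n$ by deleting the edges of a copy of $H$. *)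

theory Defs
  imports
    "Graph_Theory.Graph_Theory"
    "Jordan_Normal_Form.Spectral_Radius"
begin

text \<open>
  A finite simple graph is a \<^locale>\<open>pair_graph\<close>: a finite vertex set together with a symmetric,
  irreflexive relation on it, an undirected edge \<open>uv\<close> being the pair of arcs \<open>(u,v)\<close>, \<open>(v,u)\<close>.
\<close>

definition path_graph :: "nat \<Rightarrow> nat pair_pre_digraph" where
  "path_graph n =
     \<lparr> pverts = {..<n}, parcs = {(i, j). i < n \<and> j < n \<and> (j = Suc i \<or> i = Suc j)} \<rparr>"

definition complete_graph :: "nat \<Rightarrow> nat pair_pre_digraph" where
  "complete_graph n = \<lparr> pverts = {..<n}, parcs = {(i, j). i < n \<and> j < n \<and> i \<noteq> j} \<rparr>"

text \<open>The star has \<open>n\<close> vertices in total: the center \<open>0\<close> and \<open>n - 1\<close> leaves.\<close>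

definition star_graph :: "nat \<Rightarrow> nat pair_pre_digraph" where
  "star_graph n =
     \<lparr> pverts = {..<n}, parcs = {(i, j). i < n \<and> j < n \<and> i \<noteq> j \<and> (i = 0 \<or> j = 0)} \<rparr>"

text \<open>With unit weights, the shortest-path function of the library is the graph distance,
  with value infinity for vertices in different components.\<close>

definition graph_distance :: "'a pair_pre_digraph \<Rightarrow> 'a \<Rightarrow> 'a \<Rightarrow> ereal" where
  "graph_distance G u v = wf_digraph.\<mu> (with_proj G) (\<lambda>_. 1) u v"

definition graph_square :: "'a pair_pre_digraph \<Rightarrow> 'a pair_pre_digraph" where
  "graph_square G =
     \<lparr> pverts = pverts G,
       parcs = {(u, v). u \<in> pverts G \<and> v \<in> pverts G \<and> u \<noteq> v \<and> graph_distance G u v \<le> 2} \<rparr>"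

text \<open>The graph \<open>K\<^sub>n - E(H)\<close>, for \<open>H\<close> with vertex set contained in \<open>{..<n}\<close>, so that \<open>H\<close> itself
  is the copy whose edges are deleted. All vertices of \<open>K\<^sub>n\<close> are kept.\<close>

definition complete_minus :: "nat \<Rightarrow> nat pair_pre_digraph \<Rightarrow> nat pair_pre_digraph" where
  "complete_minus n H =
     \<lparr> pverts = pverts (complete_graph n), parcs = parcs (complete_graph n) - parcs H \<rparr>"

text \<open>Subgraph containment up to isomorphism; the subgraph need be neither induced nor spanning.\<close>

definition subgraph_up_to_iso :: "'a pair_pre_digraph \<Rightarrow> 'b pair_pre_digraph \<Rightarrow> bool" where
  "subgraph_up_to_iso H G \<longleftrightarrow>
     (\<exists>H'. digraph_iso (with_proj H) H' \<and> subgraph H' (with_proj G))"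

definition adjacency_mat :: "'a pair_pre_digraph \<Rightarrow> 'a list \<Rightarrow> real mat" where
  "adjacency_mat G vs =
     mat (length vs) (length vs) (\<lambda>(i, j). if (vs ! i, vs ! j) \<in> parcs G then 1 else 0)"

text \<open>The largest eigenvalue of the (real) adjacency matrix. The enumeration of the vertices is
  immaterial, see \<open>spectrum_adjacency_mat_unique\<close> below.\<close>

definition graph_spectral_radius :: "'a pair_pre_digraph \<Rightarrow> real" where
  "graph_spectral_radius G =
     Max (spectrum (adjacency_mat G (SOME vs. distinct vs \<and> set vs = pverts G)))"

lemma spectrum_adjacency_mat_subset:
  assumes "distinct vs" "distinct ws" "set vs = set ws"
  shows "spectrum (adjacency_mat G vs) \<subseteq> spectrum (adjacency_mat G ws)"
proof
  fix k assume "k \<in> spectrum (adjacency_mat G vs)"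
  then obtain x where x: "eigenvector (adjacency_mat G vs) x k"
    by (auto simp: spectrum_def eigenvalue_def)
  define n where "n = length vs"
  have len: "length vs = n" "length ws = n"
    using assms by (metis n_def distinct_card)+
  have x1: "x \<in> carrier_vec n" "x \<noteq> 0\<^sub>v n" and x2: "adjacency_mat G vs *\<^sub>v x = k \<cdot>\<^sub>v x"
    using x by (auto simp: eigenvector_def adjacency_mat_def len)
  define p where "p i = (THE j. j < n \<and> vs ! j = ws ! i)" for i
  have p: "p i < n \<and> vs ! p i = ws ! i" if "i < n" for i
  proof -
    have "ws ! i \<in> set vs" using that assms(3) len by simp
    then obtain j where "j < n" and "vs ! j = ws ! i" by (auto simp: in_set_conv_nth len)
    moreover have "j' = j" if "j' < n" "vs ! j' = ws ! i" for j'
      using that nth_eq_iff_index_eq[OF assms(1), of j' j] calculation len(1) by simp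
    ultimately have "\<exists>!j. j < n \<and> vs ! j = ws ! i" by blast
    then show ?thesis unfolding p_def by (rule theI')
  qed
  have inj: "inj_on p {..<n}"
    by (rule inj_onI) (metis assms(2) len(2) lessThan_iff nth_eq_iff_index_eq p)
  have img: "p ` {..<n} = {..<n}"
    by (rule card_subset_eq) (use p inj in \<open>auto simp: card_image\<close>)
  define y where "y = vec n (\<lambda>i. x $ p i)"
  have row: "(\<Sum>j<n. (if (vs ! i, vs ! j) \<in> parcs G then 1 else 0) * x $ j) = k * x $ i"
    if "i < n" for i
  proof -
    have "(adjacency_mat G vs *\<^sub>v x) $ i = (k \<cdot>\<^sub>v x) $ i" by (simp add: x2)
    then show ?thesis using that x1
      by (simp add: adjacency_mat_def len scalar_prod_def atLeast0LessThan)
  qed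
  have "(adjacency_mat G ws *\<^sub>v y) $ i = (k \<cdot>\<^sub>v y) $ i" if i: "i < n" for i
  proof -
    have "(adjacency_mat G ws *\<^sub>v y) $ i =
        (\<Sum>j<n. (if (ws ! i, ws ! j) \<in> parcs G then 1 else 0) * x $ p j)"
      using i by (simp add: adjacency_mat_def len scalar_prod_def y_def atLeast0LessThan)
    also have "\<dots> = (\<Sum>j<n. (if (vs ! p i, vs ! p j) \<in> parcs G then 1 else 0) * x $ p j)"
      using p i by (intro sum.cong) auto
    also have "\<dots> = (\<Sum>j\<in>p ` {..<n}. (if (vs ! p i, vs ! j) \<in> parcs G then 1 else 0) * x $ j)"
      by (subst sum.reindex[OF inj]) simp
    also have "\<dots> = k * x $ p i" using row[of "p i"] p[OF i] by (simp add: img)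
    finally show ?thesis using i by (simp add: y_def)
  qed
  then have "adjacency_mat G ws *\<^sub>v y = k \<cdot>\<^sub>v y"
    by (intro eq_vecI) (auto simp: adjacency_mat_def len y_def)
  moreover have "y \<noteq> 0\<^sub>v n"
  proof
    assume y0: "y = 0\<^sub>v n"
    have "x $ j = 0" if "j < n" for j
    proof -
      have "j \<in> p ` {..<n}" using that img by simp
      then obtain i where i: "i < n" "j = p i" by blast
      have "y $ i = 0" using y0 i(1) by simp
      then show ?thesis using i by (simp add: y_def)
    qed
    then have "x = 0\<^sub>v n" using x1(1) by (intro eq_vecI) auto
    with x1(2) show False ..
  qed
  ultimately have "eigenvector (adjacency_mat G ws) y k"
    by (auto simp: eigenvector_def adjacency_mat_def len y_def)
  then show "k \<in> spectrum (adjacency_mat G ws)"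
    by (auto simp: spectrum_def eigenvalue_def)
qed

lemma spectrum_adjacency_mat_unique:
  assumes "distinct vs" "distinct ws" "set vs = set ws"
  shows "spectrum (adjacency_mat G vs) = spectrum (adjacency_mat G ws)"
  using assms spectrum_adjacency_mat_subset by blast

end

theory Submission
  imports Defs
begin

text \<open>
  Suppose that all degrees of \<open>G\<close> are at least 2, let \<open>A\<close> be its adjacency matrix, \<open>x\<close> an
  eigenvector for \<open>\<mu> > n - 2\<close>, and \<open>y = \<bar>x\<bar>\<close>. Then \<open>Ay \<ge> \<mu>y\<close> entrywise, so that for
  \<open>0 \<le> c \<le> n - 2\<close> the sum of the entries of \<open>(A\<^sup>2 - cA)y\<close> exceeds \<open>(n - 2)(n - 2 - c)\<close> times
  that of \<open>y\<close>; hence some row sum of \<open>A\<^sup>2 - cA\<close> exceeds \<open>(n - 2)(n - 2 - c)\<close>. For \<open>c = 1\<close> this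
  forces the complement to have at most \<open>n - 3\<close> edges.

  A graph with at most \<open>n - 3\<close> edges on \<open>n\<close> vertices has a vertex ordering in which adjacent
  vertices are at least three places apart (so the complement contains \<open>P\<^sub>n\<^sup>2\<close>), unless it is a
  \<open>K\<^sub>3\<close> with \<open>n = 6\<close> or a \<open>K\<^sub>4\<close> with \<open>n = 9\<close>, apart from isolated vertices. This goes by
  induction. A leaf is put back at one end of the ordering. Without leaves there are three isolated
  vertices; a vertex of degree at least 3 is removed together with two of them, which then
  separate it from the rest, and in a graph of maximum degree 2 a vertex of degree 2 is removed
  together with one of them. The exception \<open>K\<^sub>4\<close> is excluded by the row sums for \<open>c = 4\<close>.
\<close>

subsection \<open>Orderings with adjacent vertices at least three places apart\<close>

text \<open>Here \<open>R\<close> will be the complement of the graph. A \<open>spread\<close>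
  listing of all vertices then makes entries one or two places apart adjacent in the graph itself,
  which is a copy of the square of a path.\<close>

fun spread :: "'a rel \<Rightarrow> 'a list \<Rightarrow> bool" where
  "spread R [] = True"
| "spread R (x # xs) = ((\<forall>y\<in>set (take 2 xs). (x, y) \<notin> R) \<and> spread R xs)"

lemma spread_nth:
  assumes "spread R xs" "i < j" "j \<le> i + 2" "j < length xs"
  shows "(xs ! i, xs ! j) \<notin> R"
  using assms
proof (induction xs arbitrary: i j)
  case (Cons x xs)
  obtain j' where j: "j = Suc j'" using Cons.prems(2) by (cases j) auto
  show ?case
  proof (cases i)
    case 0
    have "xs ! j' = take 2 xs ! j'" "j' < length (take 2 xs)"
      using 0 j Cons.prems by auto
    then have "xs ! j' \<in> set (take 2 xs)" by (metis nth_mem)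
    then show ?thesis using 0 j Cons.prems(1) by auto
  next
    case (Suc i')
    then show ?thesis using Cons j by auto
  qed
qed simp

text \<open>Inserting \<open>v\<close> only moves other entries further apart, so the pairs to check
  are \<open>v\<close> with the two entries on either side.\<close>

lemma spread_insert:
  assumes "spread R (xs @ ys)" "sym R"
    and "\<forall>y\<in>set (take 2 (rev xs)) \<union> set (take 2 ys). (v, y) \<notin> R"
  shows "spread R (xs @ v # ys)"
  using assms
proof (induction xs)
  case (Cons x xs)
  have "set (take 2 (rev xs)) \<subseteq> set (take 2 (rev (x # xs)))" by simp
  then have IH: "spread R (xs @ v # ys)" using Cons by auto
  have step: "set (take 2 (xs @ v # ys)) \<subseteq> set (take 2 (xs @ ys)) \<union> (if length xs < 2 then {v} else {})"
  proof (cases xs)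
    case Nil
    then show ?thesis using set_take_subset_set_take[of 1 2 ys] by auto
  next
    case (Cons a as)
    then show ?thesis by (cases as) auto
  qed
  have "length xs < 2 \<Longrightarrow> x \<in> set (take 2 (rev (x # xs)))"
    by (auto simp: take_Cons')
  then have "length xs < 2 \<Longrightarrow> (x, v) \<notin> R" using Cons.prems(2,3) by (auto dest: symD)
  then have "\<forall>y\<in>set (take 2 (xs @ v # ys)). (x, y) \<notin> R"
    using step Cons.prems(1) by (auto split: if_splits)
  then show ?case using IH by simp
qed simp

text \<open>Lets a distinguished vertex, if it lies in \<open>S\<close>, take a known slot of an
  explicit listing, which avoids a case distinction on its position.\<close>

lemma exists_list_with_head:
  assumes "finite S"
  shows "\<exists>us. distinct us \<and> set us = S \<and> (u \<in> S \<longrightarrow> hd us = u)"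
proof -
  obtain vs where "distinct vs" "set vs = S - {u}" using assms finite_distinct_list by blast
  then show ?thesis
    by (intro exI[of _ "if u \<in> S then u # vs else vs"]) auto
qed

section \<open>Vertex deletion and edge counting\<close>

definition del_vertex :: "'a rel \<Rightarrow> 'a \<Rightarrow> 'a rel" where
  "del_vertex R v = {(x, y) \<in> R. x \<noteq> v \<and> y \<noteq> v}"

text \<open>Both arcs of an edge belong to \<open>R\<close>, so \<open>card R\<close> is twice the
  number of edges; the bound \<open>card R + 6 \<le> 2 * card V\<close> used below says that there
  are at most \<open>card V - 3\<close> edges.\<close>

definition simple_rel :: "'a set \<Rightarrow> 'a rel \<Rightarrow> bool" where
  "simple_rel V R \<longleftrightarrow> finite V \<and> R \<subseteq> V \<times> V \<and> sym R \<and> irrefl R"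

lemma simple_rel_finite: "simple_rel V R \<Longrightarrow> finite V \<and> finite R"
  unfolding simple_rel_def by (meson finite_SigmaI finite_subset)

lemma simple_rel_del_vertex:
  assumes "simple_rel V R" shows "simple_rel (V - {v}) (del_vertex R v)"
  using assms unfolding simple_rel_def del_vertex_def sym_def irrefl_def by auto

lemma simple_rel_isolated:
  assumes "simple_rel V R" "R `` {w} = {}" shows "simple_rel (V - {w}) R"
  using assms unfolding simple_rel_def sym_def irrefl_def by auto

lemma decompose_at_vertex:
  assumes "simple_rel V R"
  shows "R = del_vertex R v \<union> {v} \<times> R `` {v} \<union> R `` {v} \<times> {v}"
  using assms unfolding simple_rel_def del_vertex_def sym_def by auto

lemma finite_Image_simple_rel: "simple_rel V R \<Longrightarrow> finite (R `` {v})"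
  by (metis simple_rel_finite finite_Image)

lemma card_del_vertex:
  assumes "simple_rel V R"
  shows "card R = card (del_vertex R v) + 2 * card (R `` {v})"
proof -
  let ?N = "R `` {v}"
  have fin: "finite (del_vertex R v)" "finite ?N"
    using simple_rel_finite[OF assms] by (auto simp: del_vertex_def intro: rev_finite_subset)
  have "v \<notin> ?N" using assms by (auto simp: simple_rel_def irrefl_def)
  then have "card ({v} \<times> ?N \<union> ?N \<times> {v}) = 2 * card ?N"
    using fin by (subst card_Un_disjoint) (auto simp: card_cartesian_product)
  moreover have "card (del_vertex R v \<union> ({v} \<times> ?N \<union> ?N \<times> {v}))
      = card (del_vertex R v) + card ({v} \<times> ?N \<union> ?N \<times> {v})"
    using fin by (intro card_Un_disjoint) (auto simp: del_vertex_def)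
  ultimately show ?thesis using decompose_at_vertex[OF assms, of v] by (simp add: Un_assoc)
qed

text \<open>Deleting a vertex removes twice its degree many arcs. The parity later sharpens a strict
  bound on arcs by one further edge.\<close>

lemma even_card_simple_rel: "simple_rel V R \<Longrightarrow> even (card R)"
proof (induction "card V" arbitrary: V R)
  case 0
  then have "V = {}" using simple_rel_finite by fastforce
  then show ?case using 0 by (simp add: simple_rel_def)
next
  case (Suc n)
  then obtain v where v: "v \<in> V" by fastforce
  have "n = card (V - {v})" using Suc v simple_rel_finite by fastforce
  then have "even (card (del_vertex R v))"
    using Suc(1) simple_rel_del_vertex[OF Suc(3)] by blast
  then show ?case using card_del_vertex[OF Suc(3), of v] by simp
qed

lemma sum_degrees:
  assumes "simple_rel V R"
  shows "card R = (\<Sum>v\<in>V. card (R `` {v}))"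
proof -
  have "R = (SIGMA v:V. R `` {v})" using assms by (auto simp: simple_rel_def)
  then have "card R = card (SIGMA v:V. R `` {v})" by simp
  also have "\<dots> = (\<Sum>v\<in>V. card (R `` {v}))"
    using assms finite_Image_simple_rel[OF assms] simple_rel_finite[OF assms] by (intro card_SigmaI) auto
  finally show ?thesis .
qed

section \<open>Orderable graphs and the two exceptional cliques\<close>

definition spreadable :: "'a set \<Rightarrow> 'a rel \<Rightarrow> bool" where
  "spreadable V R \<longleftrightarrow> (\<exists>xs. distinct xs \<and> set xs = V \<and> spread R xs)"

text \<open>Members of a \<open>k\<close>-clique must be three places apart, which takes
  \<open>3k - 2\<close> positions. A clique that does not fit, so \<open>n \<le> 3k - 3\<close>, but
  has at most \<open>n - 3\<close> edges satisfies \<open>(k - 3)(k - 4) \<le> 0\<close>; this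
  leaves exactly \<open>k = 3\<close>, \<open>n = 6\<close> and \<open>k = 4\<close>,
  \<open>n = 9\<close>.\<close>

definition critical_clique :: "'a set \<Rightarrow> 'a rel \<Rightarrow> bool" where
  "critical_clique V R \<longleftrightarrow>
     (\<exists>T\<subseteq>V. (card V = 6 \<and> card T = 3 \<or> card V = 9 \<and> card T = 4) \<and> R = T \<times> T - Id)"

lemma spread_cong:
  assumes "\<And>x y. x \<in> set xs \<Longrightarrow> y \<in> set xs \<Longrightarrow> (x, y) \<in> R \<longleftrightarrow> (x, y) \<in> R'"
  shows "spread R xs \<longleftrightarrow> spread R' xs"
  using assms
proof (induction xs)
  case (Cons x xs)
  have "\<forall>y\<in>set (take 2 xs). (x, y) \<in> R \<longleftrightarrow> (x, y) \<in> R'"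
    using Cons.prems by (auto dest: in_set_takeD)
  then show ?case using Cons by auto
qed simp

lemma spread_del_vertex: "v \<notin> set xs \<Longrightarrow> spread (del_vertex R v) xs \<longleftrightarrow> spread R xs"
  by (rule spread_cong) (auto simp: del_vertex_def)

lemma spread_empty: "spread {} xs"
  by (induction xs) auto

lemma spread_snoc:
  "\<lbrakk>spread R xs; sym R; \<forall>y\<in>set (take 2 (rev xs)). (v, y) \<notin> R\<rbrakk> \<Longrightarrow> spread R (xs @ [v])"
  using spread_insert[of R xs "[]" v] by simp

lemma ends_disjoint:
  assumes "distinct xs" "4 \<le> length xs" "u \<in> set (take 2 xs)"
  shows "u \<notin> set (take 2 (rev xs))"
proof -
  obtain x y zs where xs: "xs = x # y # zs"
    using assms(2) by (cases xs; cases "tl xs") auto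
  then have "set (take 2 (rev xs)) \<subseteq> set zs"
    using assms(2) set_take_subset[of 2 "rev zs"] by auto
  then show ?thesis using assms xs by auto
qed

lemma list_of_length_3: "length us = 3 \<Longrightarrow> \<exists>a b c. us = [a, b, c]"
  by (auto simp: numeral_eq_Suc length_Suc_conv)

lemma list_of_length_4: "length us = 4 \<Longrightarrow> \<exists>a b c d. us = [a, b, c, d]"
  by (auto simp: numeral_eq_Suc length_Suc_conv)

lemma list_of_length_5: "length us = 5 \<Longrightarrow> \<exists>a b c d e. us = [a, b, c, d, e]"
  by (auto simp: numeral_eq_Suc length_Suc_conv)

lemma list_of_length_7: "length us = 7 \<Longrightarrow> \<exists>a b c d e f g. us = [a, b, c, d, e, f, g]"
  by (auto simp: numeral_eq_Suc length_Suc_conv)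

section \<open>Putting back a leaf\<close>

text \<open>The remaining listing has at least four entries, so its first two and last two are
  disjoint. The neighbour \<open>u\<close> avoids one of these pairs, and \<open>v\<close> goes to
  that end.\<close>

lemma spreadable_leaf:
  assumes G: "simple_rel V R" and leaf: "R `` {v} = {u}"
    and IH: "spreadable (V - {v}) (del_vertex R v)" and n: "5 \<le> card V"
  shows "spreadable V R"
proof -
  have uv: "v \<in> V" "u \<in> V" "u \<noteq> v" "sym R"
    using G leaf unfolding simple_rel_def irrefl_def by auto
  have leaf': "(v, y) \<in> R \<longleftrightarrow> y = u" for y using leaf by blast
  obtain xs where xs: "distinct xs" "set xs = V - {v}" "spread (del_vertex R v) xs"
    using IH by (auto simp: spreadable_def)
  then have sp: "spread R xs" using spread_del_vertex by fastforce
  have "length xs = card V - 1"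
    using distinct_card[OF xs(1)] xs(2) uv simple_rel_finite[OF G] by simp
  then have len: "4 \<le> length xs" using n by simp
  show ?thesis
  proof (cases "u \<in> set (take 2 xs)")
    case True
    then have "spread R (xs @ [v])"
      using ends_disjoint[OF xs(1) len] leaf' sp uv by (intro spread_snoc) auto
    then show ?thesis using xs uv unfolding spreadable_def by (intro exI[of _ "xs @ [v]"]) auto
  next
    case False
    then have "spread R (v # xs)" using leaf' sp by auto
    then show ?thesis using xs uv unfolding spreadable_def by (intro exI[of _ "v # xs"]) auto
  qed
qed

text \<open>With three remaining vertices the two ends would overlap, but here \<open>vu\<close> is
  the only edge, and its endpoints go to the two ends of the listing.\<close>

lemma spreadable_leaf_4:
  assumes G: "simple_rel V R" and leaf: "R `` {v} = {u}" and n: "card V = 4" and R: "card R \<le> 2"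
  shows "spreadable V R"
proof -
  have uv: "v \<in> V" "u \<in> V" "u \<noteq> v"
    using G leaf unfolding simple_rel_def irrefl_def by auto
  have "card (del_vertex R v) = 0" using card_del_vertex[OF G, of v] leaf R by simp
  moreover have "finite (del_vertex R v)"
    using simple_rel_finite[OF G] by (auto simp: del_vertex_def intro: rev_finite_subset)
  ultimately have "R = {(v, u), (u, v)}"
    using decompose_at_vertex[OF G, of v] leaf by auto
  moreover have "card (V - {v, u}) = 2" using uv n simple_rel_finite[OF G] by (simp add: card_Diff_subset)
  then obtain a b where "V - {v, u} = {a, b}" "a \<noteq> b" by (auto simp: card_2_iff)
  moreover have "V = {v, u} \<union> (V - {v, u})" using uv by auto
  ultimately show ?thesis unfolding spreadable_def
    using uv by (intro exI[of _ "[v, a, b, u]"]) auto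
qed

text \<open>The leaf raises the number of vertices to 7 or 10, which is exactly enough room for the
  clique. It remains to find a slot for the leaf away from \<open>u\<close>.\<close>

lemma spreadable_leaf_critical:
  assumes G: "simple_rel V R" and leaf: "R `` {v} = {u}"
    and crit: "critical_clique (V - {v}) (del_vertex R v)"
  shows "spreadable V R"
proof -
  have uv: "v \<in> V" "u \<in> V" "u \<noteq> v" and fin: "finite V"
    using G leaf unfolding simple_rel_def irrefl_def by auto
  obtain T where T: "T \<subseteq> V - {v}" "del_vertex R v = T \<times> T - Id"
    and c: "card (V - {v}) = 6 \<and> card T = 3 \<or> card (V - {v}) = 9 \<and> card T = 4"
    using crit by (auto simp: critical_clique_def)
  have R: "R = (T \<times> T - Id) \<union> {(v, u), (u, v)}"
    using decompose_at_vertex[OF G, of v] leaf T(2) by auto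
  define W where "W = V - {v} - T"
  have fT: "finite T" "finite W" using T fin finite_subset by (auto simp: W_def intro: finite_subset)
  obtain ts where ts: "distinct ts" "set ts = T" "u \<in> T \<longrightarrow> hd ts = u"
    using exists_list_with_head[OF fT(1)] by blast
  obtain ws where ws: "distinct ws" "set ws = W" "u \<in> W \<longrightarrow> hd ws = u"
    using exists_list_with_head[OF fT(2)] by blast
  have V: "V = insert v (T \<union> W)" and disj: "T \<inter> W = {}" "v \<notin> T" "v \<notin> W"
    using T uv by (auto simp: W_def)
  have cW: "card W = card (V - {v}) - card T"
    using T fT unfolding W_def by (intro card_Diff_subset) auto
  have len: "length ts = card T" "length ws = card W"
    using ts ws distinct_card by metis+
  have u: "u = hd ts \<and> u \<in> T \<and> u \<notin> W \<or> u = hd ws \<and> u \<in> W \<and> u \<notin> T"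
    using uv V ts ws disj by auto
  have nb: "(x, y) \<in> R \<Longrightarrow> x \<in> T \<and> y \<in> T \<or> x = v \<and> y = u \<or> x = u \<and> y = v" for x y
    unfolding R by auto
  from c show ?thesis
  proof
    assume "card (V - {v}) = 6 \<and> card T = 3"
    then obtain a b c x y z where l: "ts = [a, b, c]" "ws = [x, y, z]"
      using list_of_length_3[of ts] list_of_length_3[of ws] len cW by auto
    \<comment> \<open>The clique takes positions 0, 3, 6. By the choice of heads \<open>u\<close> is
      \<open>a\<close> or \<open>x\<close>, at position 0 or 1, hence at least three places before
      \<open>v\<close>. The listing for ten vertices follows the same pattern.\<close>
    let ?L = "[a, x, y, b, v, z, c]"
    have dist: "distinct (v # ts @ ws)" using ts ws disj by auto
    have TW: "T = {a, b, c}" "W = {x, y, z}" using ts ws l by auto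
    have "set ?L = V" unfolding V TW by auto
    moreover have "distinct ?L" using dist l by auto
    moreover have "u = a \<or> u = x" using u l by auto
    then have "spread R ?L" using nb dist by (auto simp: l TW)
    ultimately show ?thesis unfolding spreadable_def by blast
  next
    assume "card (V - {v}) = 9 \<and> card T = 4"
    then obtain a b c d x y z x' y' where l: "ts = [a, b, c, d]" "ws = [x, y, z, x', y']"
      using list_of_length_4[of ts] list_of_length_5[of ws] len cW by auto
    let ?L = "[a, x, y, b, v, z, c, x', y', d]"
    have dist: "distinct (v # ts @ ws)" using ts ws disj by auto
    have TW: "T = {a, b, c, d}" "W = {x, y, z, x', y'}" using ts ws l by auto
    have "set ?L = V" unfolding V TW by auto
    moreover have "distinct ?L" using dist l by auto
    moreover have "u = a \<or> u = x" using u l by auto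
    then have "spread R ?L" using nb dist by (auto simp: l TW)
    ultimately show ?thesis unfolding spreadable_def by blast
  qed
qed

section \<open>Removing a vertex together with isolated vertices\<close>

text \<open>In \<open>v # w # w' # xs\<close> the isolated \<open>w\<close> and \<open>w'\<close>
  shield \<open>v\<close> from the rest, so its neighbours may occur anywhere in
  \<open>xs\<close>.\<close>

lemma spreadable_big:
  assumes G: "simple_rel V R" and v: "v \<in> V" and W: "R `` {w} = {}" "R `` {w'} = {}"
    and w: "w \<in> V" "w' \<in> V" "w \<noteq> w'" "v \<noteq> w" "v \<noteq> w'"
    and IH: "spreadable (V - {v} - {w} - {w'}) (del_vertex R v)"
  shows "spreadable V R"
proof -
  obtain xs where xs: "distinct xs" "set xs = V - {v} - {w} - {w'}" "spread (del_vertex R v) xs"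
    using IH by (auto simp: spreadable_def)
  then have sp: "spread R xs" using spread_del_vertex[of v xs R] by auto
  have "sym R" using G by (simp add: simple_rel_def)
  then have "spread R (v # w # w' # xs)" using sp W by (auto dest: symD)
  then show ?thesis unfolding spreadable_def using xs v w
    by (intro exI[of _ "v # w # w' # xs"]) auto
qed

text \<open>A neighbour of \<open>v\<close> outside \<open>T\<close> would be a leaf, so all
  neighbours lie in \<open>T\<close>. If \<open>T\<close> is a triangle, \<open>v\<close> completes
  it to the exceptional \<open>K_4\<close> on nine vertices; if \<open>T\<close> is a
  \<open>K_4\<close>, there are twelve vertices and an explicit listing exists.\<close>

lemma critical_clique_big:
  assumes G: "simple_rel V R" and noleaf: "\<And>x u. R `` {x} \<noteq> {u}"
    and v: "3 \<le> card (R `` {v})" and R: "card R + 6 \<le> 2 * card V"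
    and W: "w \<in> V" "w' \<in> V" "w \<noteq> w'" "v \<noteq> w" "v \<noteq> w'"
    and crit: "critical_clique (V - {v} - {w} - {w'}) (del_vertex R v)"
  shows "spreadable V R \<or> critical_clique V R"
proof -
  let ?U = "V - {v} - {w} - {w'}"
  let ?N = "R `` {v}"
  have fin: "finite V" using G by (simp add: simple_rel_def)
  have "?N \<noteq> {}" using v by auto
  then have vV: "v \<in> V" using G by (auto simp: simple_rel_def)
  have U: "{v, w, w'} \<subseteq> V" "card {v, w, w'} = 3" using vV W by auto
  then have "card V = card (V - {v, w, w'}) + 3"
    using card_mono[OF fin U(1)] card_Diff_subset[OF _ U(1)] by simp
  moreover have "V - {v, w, w'} = ?U" by auto
  ultimately have cU: "card V = card ?U + 3" by simp
  obtain T where T: "T \<subseteq> ?U" "del_vertex R v = T \<times> T - Id"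
    and c: "card ?U = 6 \<and> card T = 3 \<or> card ?U = 9 \<and> card T = 4"
    using crit by (auto simp: critical_clique_def)
  have Req: "R = (T \<times> T - Id) \<union> {v} \<times> ?N \<union> ?N \<times> {v}"
    using decompose_at_vertex[OF G, of v] T(2) by auto
  have NT: "?N \<subseteq> T"
  proof
    fix x assume x: "x \<in> ?N"
    show "x \<in> T"
    proof (rule ccontr)
      assume "x \<notin> T"
      moreover have "x \<noteq> v" using x G by (auto simp: simple_rel_def irrefl_def)
      ultimately have "R `` {x} = {v}" using x by (subst Req) auto
      with noleaf show False by blast
    qed
  qed
  have fT: "finite T" using T fin by (auto intro: finite_subset)
  have vT: "v \<notin> T" using T by auto
  from c show ?thesis
  proof
    assume c6: "card ?U = 6 \<and> card T = 3"
    then have "?N = T" using NT v fT by (metis card_mono card_subset_eq le_antisym)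
    then have "R = insert v T \<times> insert v T - Id" using Req vT by auto
    moreover have "card (insert v T) = 4" using c6 fT vT by simp
    moreover have "insert v T \<subseteq> V" using T vV by auto
    ultimately have "critical_clique V R" unfolding critical_clique_def
      using c6 cU by (intro exI[of _ "insert v T"]) auto
    then show ?thesis ..
  next
    assume c9: "card ?U = 9 \<and> card T = 4"
    have "card (T \<times> T - Id) = 12"
    proof -
      have "T \<times> T - Id = T \<times> T - (\<lambda>x. (x, x)) ` T" by auto
      moreover have "card ((\<lambda>x. (x, x)) ` T) = 4" using c9 by (subst card_image) (auto simp: inj_on_def)
      ultimately show ?thesis using c9 fT
        by (simp add: card_Diff_subset card_cartesian_product image_subset_iff)
    qed
    \<comment> \<open>The edge bound reads \<open>12 + 2 * card ?N + 6 \<le> 24\<close>, so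
      \<open>v\<close> misses some \<open>d\<close> in \<open>T\<close>.\<close>
    then have "card ?N \<le> 3" using card_del_vertex[OF G, of v] T(2) R cU c9 by simp
    then have "?N \<noteq> T" using c9 by auto
    then obtain d where d: "d \<in> T" "d \<notin> ?N" using NT by auto
    obtain ts where ts: "distinct ts" "set ts = T" "hd ts = d"
      using exists_list_with_head[OF fT, of d] d by blast
    have "finite (V - {v} - T)" using fin by simp
    then obtain ws where ws: "distinct ws" "set ws = V - {v} - T"
      using finite_distinct_list by blast
    have "card (V - {v} - T) = card (V - {v}) - card T"
      using T fT by (intro card_Diff_subset) auto
    then have "length ws = 7" using distinct_card[OF ws(1)] ws(2) c9 cU vV fin by simp
    moreover have "length ts = 4" using distinct_card[OF ts(1)] ts(2) c9 by simp
    ultimately obtain a b c x1 x2 x3 x4 x5 x6 x7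
      where l: "ts = [d, a, b, c]" "ws = [x1, x2, x3, x4, x5, x6, x7]"
      using list_of_length_4[of ts] list_of_length_7[of ws] ts(3) by auto
    have V: "V = insert v (T \<union> set ws)" and disj: "T \<inter> set ws = {}" "v \<notin> set ws"
      using T vV ws by auto
    \<comment> \<open>The clique takes positions 0, 3, 6, 9. The only other non-isolated vertex
      \<open>v\<close> stands next to its non-neighbour \<open>d\<close> and at least four places
      from \<open>a\<close>, \<open>b\<close>, \<open>c\<close>.\<close>
    let ?L = "[a, x1, x2, b, x3, x4, c, x5, x6, d, v, x7]"
    have dist: "distinct (v # ts @ ws)" using ts ws disj vT by auto
    have T': "T = {d, a, b, c}" using ts l by auto
    have "distinct ?L" using dist l by auto
    moreover have "set ?L = V" unfolding V T' l by auto
    moreover have iso: "(x, y) \<notin> R \<and> (y, x) \<notin> R" if "x \<in> set ws" for x y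
      using that NT disj by (subst (1 2) Req) auto
    have "(d, v) \<notin> R" using d(2) G by (auto simp: simple_rel_def dest: symD)
    then have "spread R ?L" using iso by (simp add: l)
    ultimately show ?thesis unfolding spreadable_def by blast
  qed
qed

text \<open>With \<open>w\<close> as a buffer, \<open>v\<close> can go to an end of
  \<open>xs\<close> unless it is adjacent to the extreme entry there. If both ends are blocked, they
  are the only two neighbours of \<open>v\<close>, and \<open>v\<close> fits in the
  interior.\<close>

lemma spreadable_two_regular:
  assumes G: "simple_rel V R" and v: "card (R `` {v}) = 2" and n: "7 \<le> card V"
    and w: "w \<in> V" "R `` {w} = {}" "w \<noteq> v"
    and IH: "spreadable (V - {v} - {w}) (del_vertex R v)"
  shows "spreadable V R"
proof -
  let ?N = "R `` {v}"
  have fin: "finite V" "sym R" using G by (auto simp: simple_rel_def)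
  have "?N \<noteq> {}" using v by auto
  then have vV: "v \<in> V" using G by (auto simp: simple_rel_def)
  have vw: "(v, w) \<notin> R" using w(2) fin(2) by (auto dest: symD)
  have ww: "(w, y) \<notin> R" for y using w(2) by auto
  obtain xs where xs: "distinct xs" "set xs = V - {v} - {w}" "spread (del_vertex R v) xs"
    using IH by (auto simp: spreadable_def)
  then have sp: "spread R xs" using spread_del_vertex[of v xs R] by auto
  have "card {v, w} = 2" "{v, w} \<subseteq> V" using vV w by auto
  then have "card (V - {v, w}) = card V - 2" using card_Diff_subset[of "{v, w}" V] by simp
  moreover have "V - {v, w} = V - {v} - {w}" by auto
  ultimately have "length xs = card V - 2" using distinct_card[OF xs(1)] xs(2) by simp
  then have len: "5 \<le> length xs" using n by simp
  then obtain p s t zs where p: "xs = p # s # t # zs" "2 \<le> length zs"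
    by (cases xs; cases "tl xs"; cases "tl (tl xs)") auto
  then obtain z q zs' where q: "zs = zs' @ [z, q]"
    by (cases zs rule: rev_cases; cases "butlast zs" rule: rev_cases) auto
  \<comment> \<open>Distinctness of the new listing follows by counting: it has
    \<open>card V\<close> entries and its set is \<open>V\<close>.\<close>
  have result: "spreadable V R" if "spread R ys" "set ys = insert v (insert w (set xs))"
    "length ys = length xs + 2" for ys
  proof -
    have "set ys = V" using that xs vV w by auto
    moreover have "card V = length ys" using that \<open>length xs = card V - 2\<close> n by simp
    ultimately show ?thesis using that card_distinct[of ys] unfolding spreadable_def by metis
  qed
  consider "p \<notin> ?N" | "q \<notin> ?N" | "p \<in> ?N" "q \<in> ?N" by blast
  then show ?thesis
  proof cases
    case 1
    then have "spread R (v # w # xs)" using sp vw ww p by auto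
    then show ?thesis by (rule result) auto
  next
    case 2
    have "spread R (xs @ [w])" by (rule spread_snoc) (use sp ww fin in auto)
    then have "spread R ((xs @ [w]) @ [v])" by (rule spread_snoc) (use fin vw 2 p q in auto)
    then show ?thesis by (rule result) auto
  next
    case 3
    have "{p, q} \<subseteq> ?N" "card {p, q} = 2" using 3 p q xs(1) by auto
    then have N: "?N = {p, q}" using v finite_Image_simple_rel[OF G] by (metis card_subset_eq)
    have nN: "(v, y) \<notin> R" if "y \<in> {s, t} \<union> set zs' \<union> {z}" for y
    proof -
      have "y \<noteq> p" "y \<noteq> q" using that xs(1) p q by auto
      then show ?thesis using N by blast
    qed
    \<comment> \<open>The target is \<open>[p, s, w, v, t, ...]\<close>: inserting \<open>w\<close>
      puts \<open>p\<close> three places before \<open>v\<close>. As \<open>zs\<close> has at least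
      two entries, its last entry \<open>q\<close> is at least three places after
      \<open>v\<close>.\<close>
    have "spread R ([p, s] @ w # t # zs)"
      by (rule spread_insert) (use sp ww fin p in auto)
    then have sp3: "spread R ([p, s, w] @ t # zs)" by simp
    have "set (take 2 (rev [p, s, w])) \<union> set (take 2 (t # zs)) \<subseteq> {w, s, t} \<union> set zs' \<union> {z}"
      unfolding q by (cases zs') auto
    then have nN3: "\<forall>y\<in>set (take 2 (rev [p, s, w])) \<union> set (take 2 (t # zs)). (v, y) \<notin> R"
      using nN vw by blast
    have "spread R ([p, s, w] @ v # t # zs)" by (rule spread_insert[OF sp3 fin(2) nN3])
    then show ?thesis by (rule result) (use p in auto)
  qed
qed

text \<open>A neighbour \<open>x\<close> of \<open>v\<close> outside the clique would be a leaf;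
  inside it, \<open>x\<close> would have \<open>v\<close> and at least two clique vertices as
  neighbours, exceeding degree 2.\<close>

lemma not_critical_two_regular:
  assumes G: "simple_rel V R" and noleaf: "\<And>x u. R `` {x} \<noteq> {u}"
    and v: "card (R `` {v}) = 2" and deg: "\<And>x. card (R `` {x}) \<le> 2"
  shows "\<not> critical_clique U (del_vertex R v)"
proof
  let ?N = "R `` {v}"
  assume "critical_clique U (del_vertex R v)"
  then obtain T where T: "del_vertex R v = T \<times> T - Id" "card T = 3 \<or> card T = 4"
    by (auto simp: critical_clique_def)
  have Req: "R = (T \<times> T - Id) \<union> {v} \<times> ?N \<union> ?N \<times> {v}"
    using decompose_at_vertex[OF G, of v] T by auto
  have "?N \<noteq> {}" using v by auto
  then obtain x where x: "x \<in> ?N" by blast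
  then have xv: "x \<noteq> v" using G by (auto simp: simple_rel_def irrefl_def)
  show False
  proof (cases "x \<in> T")
    case False
    then have "R `` {x} = {v}" using x xv by (subst Req) auto
    with noleaf show False by blast
  next
    case True
    have vT: "v \<notin> T"
    proof
      assume "v \<in> T"
      then have "(v, x) \<in> del_vertex R v" using T(1) True xv by auto
      then show False by (simp add: del_vertex_def)
    qed
    have "insert v (T - {x}) \<subseteq> R `` {x}" using x xv True by (subst Req) auto
    then have "card (insert v (T - {x})) \<le> 2"
      using deg[of x] finite_Image_simple_rel[OF G] by (meson card_mono le_trans)
    moreover have "finite T" using T(2) by (metis card.infinite zero_neq_numeral)
    ultimately show False using T(2) True vT by (auto simp: card_insert_if)
  qed
qed

text \<open>Deleting \<open>v\<close> leaves at most one edge. Neither neighbour of \<open>v\<close>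
  is a leaf, so both lie on that edge, which closes a triangle. This serves the graphs too small for
  the interior insertion.\<close>

lemma triangle_of_few_edges:
  assumes G: "simple_rel V R" and noleaf: "\<And>x u. R `` {x} \<noteq> {u}"
    and v: "card (R `` {v}) = 2" and R: "card R \<le> 6"
  shows "\<exists>T\<subseteq>V. card T = 3 \<and> R = T \<times> T - Id"
proof -
  obtain p q where N: "R `` {v} = {p, q}" "p \<noteq> q" using v by (auto simp: card_2_iff)
  let ?D = "del_vertex R v"
  have sym: "sym R" and irr: "irrefl R" and sub: "R \<subseteq> V \<times> V" using G by (auto simp: simple_rel_def)
  have fD: "finite ?D" using simple_rel_finite[OF simple_rel_del_vertex[OF G]] by blast
  have cD: "card ?D \<le> 2" using card_del_vertex[OF G, of v] v R by simp
  have nb: "\<exists>y. (x, y) \<in> ?D" if "x \<in> {p, q}" for x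
  proof -
    have "v \<in> R `` {x}" using that N sym by (auto dest: symD)
    then obtain y where "y \<noteq> v" "(x, y) \<in> R" using noleaf[of x v] by blast
    moreover have "x \<noteq> v" using that N irr by (auto simp: irrefl_def)
    ultimately show ?thesis by (auto simp: del_vertex_def)
  qed
  obtain y z where y: "(p, y) \<in> ?D" and z: "(q, z) \<in> ?D" using nb by blast
  have "(y, p) \<in> ?D" "y \<noteq> p" using y sym irr by (auto simp: del_vertex_def irrefl_def dest: symD)
  then have "{(p, y), (y, p)} \<subseteq> ?D" "card {(p, y), (y, p)} = 2" using y by auto
  then have D: "?D = {(p, y), (y, p)}" using cD fD by (metis card_seteq)
  then have "y = q" using z N by auto
  then have "R = {v, p, q} \<times> {v, p, q} - Id"
    using decompose_at_vertex[OF G, of v] D N irr by (auto simp: irrefl_def)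
  moreover have "{v, p, q} \<subseteq> V" using N sub by auto
  moreover have "v \<noteq> p" "v \<noteq> q" using N irr by (auto simp: irrefl_def)
  then have "card {v, p, q} = 3" using N by simp
  ultimately show ?thesis by blast
qed

section \<open>The induction on the number of vertices\<close>

text \<open>Without leaves every non-isolated vertex has degree at least 2, so there are at most as
  many of them as edges, that is, at most \<open>card V - 3\<close>.\<close>

lemma isolated_vertices:
  assumes G: "simple_rel V R" and noleaf: "\<And>x u. R `` {x} \<noteq> {u}"
    and R: "card R + 6 \<le> 2 * card V"
  shows "\<exists>w w'. w \<in> V \<and> w' \<in> V \<and> w \<noteq> w' \<and> R `` {w} = {} \<and> R `` {w'} = {}"
proof -
  let ?I = "{x \<in> V. R `` {x} = {}}"
  have fin: "finite V" using G by (simp add: simple_rel_def)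
  have deg: "2 \<le> card (R `` {x})" if "x \<in> V - ?I" for x
  proof -
    have "card (R `` {x}) \<noteq> 0" using that finite_Image_simple_rel[OF G] by auto
    moreover have "card (R `` {x}) \<noteq> 1" using noleaf by (auto simp: card_1_singleton_iff)
    ultimately show ?thesis by linarith
  qed
  have "2 * card (V - ?I) \<le> (\<Sum>x\<in>V - ?I. card (R `` {x}))"
    using sum_bounded_below[of "V - ?I" 2 "\<lambda>x. card (R `` {x})", OF deg] by (simp add: mult.commute)
  also have "\<dots> \<le> card R" unfolding sum_degrees[OF G] using fin by (intro sum_mono2) auto
  finally have "2 * card (V - ?I) \<le> card R" .
  moreover have "card (V - ?I) = card V - card ?I" using fin by (intro card_Diff_subset) auto
  ultimately have "2 * card V \<le> card R + 2 * card ?I" by simp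
  then have "2 \<le> card ?I" using R by simp
  then obtain S where S: "S \<subseteq> ?I" "card S = 2" by (rule obtain_subset_with_card_n)
  obtain w w' where "S = {w, w'}" "w \<noteq> w'" using S(2) unfolding card_2_iff by blast
  then show ?thesis using S(1) by blast
qed

text \<open>Each reduction deletes at least as many edges as vertices, which preserves the bound:
  one vertex for a leaf, three for a vertex of degree at least 3, two for a vertex of degree
  2.\<close>

lemma spreadable_or_critical:
  assumes "simple_rel V R" and "card R + 6 \<le> 2 * card V"
  shows "spreadable V R \<or> critical_clique V R"
  using assms
proof (induction "card V" arbitrary: V R rule: less_induct)
  case less
  note G = less.prems(1) and R = less.prems(2)
  have fin: "finite V" and sub: "R \<subseteq> V \<times> V" using G by (auto simp: simple_rel_def)
  show ?case
  proof (cases "\<exists>v u. R `` {v} = {u}")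
    case True
    then obtain v u where leaf: "R `` {v} = {u}" by blast
    then have vV: "v \<in> V" using sub by auto
    have card: "card R = card (del_vertex R v) + 2" "card V = card (V - {v}) + 1"
      using card_del_vertex[OF G, of v] leaf card.remove[OF fin vV] by simp_all
    show ?thesis
    proof (cases "card V = 4")
      case True
      then show ?thesis using spreadable_leaf_4[OF G leaf] R by simp
    next
      case False
      then have n: "5 \<le> card V" using R card by simp
      have "spreadable (V - {v}) (del_vertex R v) \<or> critical_clique (V - {v}) (del_vertex R v)"
        using R card by (intro less.hyps simple_rel_del_vertex[OF G]) auto
      then show ?thesis using spreadable_leaf[OF G leaf _ n] spreadable_leaf_critical[OF G leaf] by blast
    qed
  next
    case False
    then have noleaf: "\<And>x u. R `` {x} \<noteq> {u}" by blast
    obtain w w' where w: "w \<in> V" "w' \<in> V" "w \<noteq> w'" "R `` {w} = {}" "R `` {w'} = {}"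
      using isolated_vertices[OF G noleaf R] by blast
    consider "R = {}" | v where "3 \<le> card (R `` {v})"
      | "R \<noteq> {}" "\<And>x. card (R `` {x}) \<le> 2"
    proof (cases "\<exists>v. 3 \<le> card (R `` {v})")
      case False
      then have "card (R `` {x}) \<le> 2" for x
        by (metis not_less_eq_eq numeral_3_eq_3 numeral_2_eq_2)
      then show ?thesis using that by blast
    qed (use that in blast)
    then show ?thesis
    proof cases
      case 1
      then show ?thesis using finite_distinct_list[OF fin] spread_empty unfolding spreadable_def by blast
    next
      case (2 v)
      then have ne: "R `` {v} \<noteq> {}" by auto
      then have vV: "v \<in> V" and vw: "v \<noteq> w" "v \<noteq> w'" using sub w by auto
      have iso: "del_vertex R v `` {w} = {}" "del_vertex R v `` {w'} = {}"
        using w by (auto simp: del_vertex_def)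
      have G': "simple_rel (V - {v} - {w} - {w'}) (del_vertex R v)"
        using iso by (intro simple_rel_isolated simple_rel_del_vertex[OF G])
      have "{v, w, w'} \<subseteq> V" "card {v, w, w'} = 3" using vV w vw by auto
      then have "card (V - {v, w, w'}) + 3 = card V"
        using card_mono[OF fin, of "{v, w, w'}"] card_Diff_subset[of "{v, w, w'}" V] by simp
      moreover have "V - {v, w, w'} = V - {v} - {w} - {w'}" by auto
      ultimately have "card (V - {v} - {w} - {w'}) + 3 = card V" by simp
      then have "spreadable (V - {v} - {w} - {w'}) (del_vertex R v)
          \<or> critical_clique (V - {v} - {w} - {w'}) (del_vertex R v)"
        using 2 R card_del_vertex[OF G, of v] by (intro less.hyps G') auto
      then show ?thesis
        using spreadable_big[OF G vV w(4,5,1,2,3) vw] critical_clique_big[OF G noleaf 2 R w(1,2,3) vw]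
        by blast
    next
      case 3
      then obtain v y where "(v, y) \<in> R" by auto
      then have "card (R `` {v}) \<noteq> 0" using finite_Image_simple_rel[OF G] by auto
      moreover have "card (R `` {v}) \<noteq> 1" using noleaf by (auto simp: card_1_singleton_iff)
      ultimately have v: "card (R `` {v}) = 2" using 3(2)[of v] by linarith
      have vV: "v \<in> V" and vw: "w \<noteq> v" using \<open>(v, y) \<in> R\<close> sub w by auto
      show ?thesis
      proof (cases "7 \<le> card V")
        case True
        have G': "simple_rel (V - {v} - {w}) (del_vertex R v)"
          using w by (intro simple_rel_isolated simple_rel_del_vertex[OF G]) (auto simp: del_vertex_def)
        have "card (V - {v} - {w}) + 2 = card V" using vV w(1) vw fin True by (simp add: card_Diff_singleton)
        then have "spreadable (V - {v} - {w}) (del_vertex R v) \<or> critical_clique (V - {v} - {w}) (del_vertex R v)"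
          using R v card_del_vertex[OF G, of v] by (intro less.hyps G') auto
        then show ?thesis
          using spreadable_two_regular[OF G v True w(1,4) vw] not_critical_two_regular[OF G noleaf v 3(2)]
          by blast
      next
        case False
        \<comment> \<open>At most six vertices remain to be treated, hence at most three edges. The
          triangle found has three edges, and the bound then forces exactly six vertices.\<close>
        then have "card R \<le> 6" using R by simp
        then obtain T where T: "T \<subseteq> V" "card T = 3" "R = T \<times> T - Id"
          using triangle_of_few_edges[OF G noleaf v] by blast
        have "card R = 6"
        proof -
          have "finite T" using T(1) fin finite_subset by blast
          moreover have "T \<times> T - Id = T \<times> T - (\<lambda>x. (x, x)) ` T" by auto
          moreover have "card ((\<lambda>x. (x, x)) ` T) = 3" using T by (subst card_image) (auto simp: inj_on_def)
          ultimately show ?thesis using T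
            by (simp add: card_Diff_subset card_cartesian_product image_subset_iff)
        qed
        then have "card V = 6" using R False by simp
        then show ?thesis using T unfolding critical_clique_def by blast
      qed
    qed
  qed
qed

subsection \<open>Spectral radius and degrees\<close>

text \<open>Self-adjointness of the adjacency operator.\<close>

lemma sum_Image_symmetric:
  fixes g h :: "'a \<Rightarrow> real"
  assumes "finite V" "E \<subseteq> V \<times> V" "sym E"
  shows "(\<Sum>v\<in>V. (\<Sum>w\<in>E `` {v}. g w) * h v) = (\<Sum>v\<in>V. g v * (\<Sum>w\<in>E `` {v}. h w))"
proof -
  have E: "E `` {v} = {w \<in> V. (v, w) \<in> E}" for v using assms(2) by auto
  have "(\<Sum>v\<in>V. (\<Sum>w\<in>E `` {v}. g w) * h v) = (\<Sum>v\<in>V. \<Sum>w\<in>V. if (v, w) \<in> E then g w * h v else 0)"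
    unfolding E sum_distrib_right using assms(1) by (simp add: sum.inter_filter)
  also have "\<dots> = (\<Sum>w\<in>V. \<Sum>v\<in>V. if (w, v) \<in> E then g w * h v else 0)"
    by (subst sum.swap) (intro sum.cong refl if_cong, use assms(3) in \<open>auto dest: symD\<close>)
  also have "\<dots> = (\<Sum>v\<in>V. g v * (\<Sum>w\<in>E `` {v}. h w))"
    unfolding E sum_distrib_left using assms(1) by (simp add: sum.inter_filter)
  finally show ?thesis .
qed

text \<open>The sum in the conclusion is the row sum of \<open>A^2 - cA\<close> at \<open>v\<close>.
  Using \<open>\<bar>f\<bar>\<close> as weights gives a nonnegative vector with
  \<open>Ay \<ge> my\<close> without needing the eigenvector itself to be nonnegative.\<close>

lemma exists_large_shifted_degree_sum:
  fixes f :: "'a \<Rightarrow> real"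
  assumes V: "finite V" "E \<subseteq> V \<times> V" "sym E"
    and eig: "\<And>v. v \<in> V \<Longrightarrow> (\<Sum>w\<in>E `` {v}. f w) = m * f v"
    and f: "u \<in> V" "f u \<noteq> 0" and c: "0 \<le> c" "c \<le> k" and m: "k < m"
  shows "\<exists>v\<in>V. (\<Sum>w\<in>E `` {v}. real (card (E `` {w})) - c) > k * (k - c)"
proof (rule ccontr)
  assume "\<not> ?thesis"
  then have small: "(\<Sum>w\<in>E `` {v}. real (card (E `` {w})) - c) \<le> k * (k - c)" if "v \<in> V" for v
    using that by force
  define A where "A g v = (\<Sum>w\<in>E `` {v}. g w)" for g :: "'a \<Rightarrow> real" and v
  define d where "d v = real (card (E `` {v}))" for v
  define y where "y v = \<bar>f v\<bar>" for v
  define S where "S = (\<Sum>v\<in>V. y v)"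
  have adj: "(\<Sum>v\<in>V. A g v * h v) = (\<Sum>v\<in>V. g v * A h v)" for g h
    unfolding A_def by (rule sum_Image_symmetric[OF V])
  have sub: "E `` {v} \<subseteq> V" for v using V(2) by auto
  have Ay: "m * y v \<le> A y v" if "v \<in> V" for v
  proof -
    have "m * y v = \<bar>\<Sum>w\<in>E `` {v}. f w\<bar>" using eig[OF that] m c by (simp add: y_def abs_mult)
    also have "\<dots> \<le> A y v" unfolding A_def y_def by (rule sum_abs)
    finally show ?thesis .
  qed
  have "0 < y u" using f by (simp add: y_def)
  also have "y u \<le> S" unfolding S_def using f V by (intro member_le_sum) (auto simp: y_def)
  finally have S: "0 < S" .
  have AAy: "m * A y v \<le> A (A y) v" for v
    unfolding A_def[of y v] A_def[of "A y" v] sum_distrib_left using sub by (intro sum_mono Ay) auto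
  have d: "d v = A (\<lambda>_. 1) v" for v by (simp add: A_def d_def)
  \<comment> \<open>The entry sum of \<open>(A^2 - cA)y\<close> is evaluated in two ways: as row
    sums weighted by \<open>y\<close>, bounded by assumption, and through the growth of
    \<open>y\<close> under \<open>A\<close>.\<close>
  have "k * (k - c) * S \<ge> (\<Sum>v\<in>V. y v * A (\<lambda>w. d w - c) v)"
    unfolding S_def sum_distrib_left
    using small by (intro sum_mono) (auto simp: A_def d_def y_def mult.commute intro: mult_left_mono)
  also have "(\<Sum>v\<in>V. y v * A (\<lambda>w. d w - c) v) = (\<Sum>v\<in>V. A y v * (d v - c))"
    by (rule adj[symmetric])
  also have "\<dots> = (\<Sum>v\<in>V. A y v * A (\<lambda>_. 1) v) - c * (\<Sum>v\<in>V. A y v)"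
    by (simp add: d algebra_simps sum_subtractf sum_distrib_left)
  also have "(\<Sum>v\<in>V. A y v * A (\<lambda>_. 1) v) = (\<Sum>v\<in>V. A (A y) v)"
    using adj[of "A y" "\<lambda>_. 1"] by simp
  finally have 1: "(\<Sum>v\<in>V. A (A y) v) - c * (\<Sum>v\<in>V. A y v) \<le> k * (k - c) * S" .
  have "m * (\<Sum>v\<in>V. A y v) \<le> (\<Sum>v\<in>V. A (A y) v)"
    unfolding sum_distrib_left using AAy by (intro sum_mono)
  with 1 have 2: "(m - c) * (\<Sum>v\<in>V. A y v) \<le> k * (k - c) * S" by (simp add: algebra_simps)
  have "m * S \<le> (\<Sum>v\<in>V. A y v)"
    unfolding S_def sum_distrib_left using Ay by (intro sum_mono)
  then have "(m - c) * (m * S) \<le> (m - c) * (\<Sum>v\<in>V. A y v)"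
    using m c by (intro mult_left_mono) auto
  with 2 have "((m - c) * m) * S \<le> (k * (k - c)) * S" by (simp add: algebra_simps)
  then have "(m - c) * m \<le> k * (k - c)" using S by simp
  moreover have "k * (k - c) \<le> k * (m - c)" using m c by (intro mult_left_mono) auto
  moreover have "k * (m - c) < m * (m - c)" using m c by (intro mult_strict_right_mono) auto
  ultimately show False by (simp add: mult.commute)
qed

section \<open>Real eigenvalues and eigenfunctions of a graph\<close>

text \<open>A complex eigenvalue \<open>k\<close> exists; the Hermitian form of its eigenvector is
  both real and \<open>k\<close> times a positive number, so \<open>k\<close> is real. The
  eigenvector may be non-real, so the characteristic polynomial carries \<open>k\<close> back to the
  real matrix.\<close>

lemma real_symmetric_spectrum_nonempty:
  fixes A :: "real mat"
  assumes A: "A \<in> carrier_mat n n" and n: "n \<noteq> 0"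
    and sym: "\<And>i j. i < n \<Longrightarrow> j < n \<Longrightarrow> A $$ (i, j) = A $$ (j, i)"
  shows "spectrum A \<noteq> {}"
proof -
  define B where "B = map_mat complex_of_real A"
  have B: "B \<in> carrier_mat n n" using A by (simp add: B_def)
  obtain k where kB: "eigenvalue B k"
    using spectrum_non_empty[OF B] n by (auto simp: spectrum_def)
  then obtain v where v: "v \<in> carrier_vec n" "v \<noteq> 0\<^sub>v n" "B *\<^sub>v v = k \<cdot>\<^sub>v v"
    using B by (auto simp: eigenvalue_def eigenvector_def)
  have row: "(\<Sum>j<n. complex_of_real (A $$ (i, j)) * v $ j) = k * v $ i" if "i < n" for i
  proof -
    have "(B *\<^sub>v v) $ i = (k \<cdot>\<^sub>v v) $ i" by (simp add: v)
    then show ?thesis using that v A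
      by (simp add: B_def scalar_prod_def atLeast0LessThan)
  qed
  define Q where "Q = (\<Sum>i<n. \<Sum>j<n. cnj (v $ i) * (complex_of_real (A $$ (i, j)) * v $ j))"
  define N where "N = (\<Sum>i<n. (cmod (v $ i))\<^sup>2)"
  have "cnj Q = (\<Sum>i<n. \<Sum>j<n. cnj (v $ j) * (complex_of_real (A $$ (j, i)) * v $ i))"
    unfolding Q_def cnj_sum by (intro sum.cong refl) (auto simp: sym)
  also have "\<dots> = Q" unfolding Q_def by (rule sum.swap)
  finally have "cnj Q = Q" .
  moreover have "Q = k * complex_of_real N"
  proof -
    have "Q = (\<Sum>i<n. cnj (v $ i) * (k * v $ i))"
      unfolding Q_def by (intro sum.cong refl) (simp add: row flip: sum_distrib_left)
    also have "\<dots> = (\<Sum>i<n. k * complex_of_real ((cmod (v $ i))\<^sup>2))"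
      by (intro sum.cong refl) (metis complex_norm_square mult.assoc mult.commute)
    finally show ?thesis by (simp add: N_def sum_distrib_left)
  qed
  moreover have "N \<noteq> 0"
  proof
    assume "N = 0"
    then have "v $ i = 0" if "i < n" for i
      using that by (auto simp: N_def sum_nonneg_eq_0_iff)
    then have "v = 0\<^sub>v n" using v(1) by (intro eq_vecI) auto
    with v(2) show False ..
  qed
  ultimately have "cnj k = k" by simp
  then have k: "k = complex_of_real (Re k)" by (simp add: complex_eq_iff)
  have "poly (char_poly B) k = 0" using kB eigenvalue_root_char_poly[OF B] by simp
  then have "poly (map_poly complex_of_real (char_poly A)) (complex_of_real (Re k)) = 0"
    using k of_real_hom.char_poly_hom[OF A, where 'a = complex] by (simp add: B_def)
  then have "poly (char_poly A) (Re k) = 0" by simp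
  then show ?thesis using eigenvalue_root_char_poly[OF A] by (auto simp: spectrum_def)
qed

lemma pair_graph_simple_rel:
  assumes "pair_graph G" shows "simple_rel (pverts G) (parcs G)"
proof -
  interpret pair_graph G by fact
  have "sym (parcs G)" using pair_sym_arcs by (simp add: symmetric_def)
  moreover have "irrefl (parcs G)" using pair_no_loops by (force simp: irrefl_def)
  moreover have "parcs G \<subseteq> pverts G \<times> pverts G"
    using arc_fst_in_verts arc_snd_in_verts by fastforce
  ultimately show ?thesis using pair_finite_verts by (simp add: simple_rel_def)
qed

text \<open>The spectrum is finite and nonempty, so its maximum is an eigenvalue. The eigenvector is
  moved from list positions to vertices, which removes the chosen enumeration from the rest of the
  argument.\<close>

lemma spectral_radius_eigenfunction:
  assumes G: "simple_rel (pverts G) (parcs G)" and ne: "pverts G \<noteq> {}"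
  shows "\<exists>f. (\<forall>v\<in>pverts G. (\<Sum>w\<in>parcs G `` {v}. f w) = graph_spectral_radius G * f v)
           \<and> (\<exists>v\<in>pverts G. f v \<noteq> 0)"
proof -
  let ?E = "parcs G"
  let ?V = "pverts G"
  have fin: "finite ?V" and sub: "?E \<subseteq> ?V \<times> ?V" and symE: "sym ?E"
    using G by (auto simp: simple_rel_def)
  define vs where "vs = (SOME vs. distinct vs \<and> set vs = ?V)"
  have "\<exists>vs. distinct vs \<and> set vs = ?V" using finite_distinct_list[OF fin] by blast
  then have vs: "distinct vs" "set vs = ?V"
    using someI_ex[of "\<lambda>vs. distinct vs \<and> set vs = ?V"] unfolding vs_def by blast+
  define n where "n = length vs"
  define M where "M = adjacency_mat G vs"
  define m where "m = graph_spectral_radius G"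
  have M: "M \<in> carrier_mat n n" by (simp add: M_def adjacency_mat_def n_def)
  have "spectrum M \<noteq> {}"
  proof (rule real_symmetric_spectrum_nonempty[OF M])
    show "n \<noteq> 0" using vs ne by (auto simp: n_def)
    show "M $$ (i, j) = M $$ (j, i)" if "i < n" "j < n" for i j
      using that symE by (auto simp: M_def adjacency_mat_def n_def dest: symD)
  qed
  then have "m \<in> spectrum M"
    unfolding m_def graph_spectral_radius_def vs_def[symmetric] M_def[symmetric]
    using card_finite_spectrum(1)[OF M] by (rule Max_in[rotated])
  then obtain x where x: "x \<in> carrier_vec n" "x \<noteq> 0\<^sub>v n" "M *\<^sub>v x = m \<cdot>\<^sub>v x"
    using M by (auto simp: spectrum_def eigenvalue_def eigenvector_def)
  have bij: "bij_betw ((!) vs) {..<n} ?V" using bij_betw_nth[OF vs(1)] vs(2) by (simp add: n_def)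
  define f where "f v = x $ inv_into {..<n} ((!) vs) v" for v
  have f: "f (vs ! i) = x $ i" if "i < n" for i
    using that bij by (simp add: f_def bij_betw_def)
  have eig: "(\<Sum>w\<in>?E `` {vs ! i}. f w) = m * f (vs ! i)" if "i < n" for i
  proof -
    have "?E `` {vs ! i} = {w \<in> ?V. (vs ! i, w) \<in> ?E}" using sub by auto
    then have "(\<Sum>w\<in>?E `` {vs ! i}. f w) = (\<Sum>w\<in>?V. if (vs ! i, w) \<in> ?E then f w else 0)"
      using fin by (simp add: sum.inter_filter)
    also have "\<dots> = (\<Sum>j<n. if (vs ! i, vs ! j) \<in> ?E then f (vs ! j) else 0)"
      by (rule sum.reindex_bij_betw[OF bij, symmetric])
    also have "\<dots> = (\<Sum>j<n. (if (vs ! i, vs ! j) \<in> ?E then 1 else 0) * x $ j)"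
      by (intro sum.cong) (auto simp: f)
    also have "\<dots> = (M *\<^sub>v x) $ i"
      using that x(1) by (simp add: M_def adjacency_mat_def scalar_prod_def atLeast0LessThan n_def)
    also have "\<dots> = m * f (vs ! i)" using that x(1) by (simp add: x(3) f)
    finally show ?thesis .
  qed
  have "\<exists>i<n. x $ i \<noteq> 0"
  proof (rule ccontr)
    assume "\<not> ?thesis"
    then have "x = 0\<^sub>v n" using x(1) by (intro eq_vecI) auto
    with x(2) show False ..
  qed
  then obtain i where "i < n" "x $ i \<noteq> 0" by blast
  then have "\<exists>v\<in>?V. f v \<noteq> 0" using f vs(2) n_def nth_mem by metis
  moreover have "(\<Sum>w\<in>?E `` {v}. f w) = m * f v" if "v \<in> ?V" for v
    using that eig vs(2) by (metis in_set_conv_nth n_def)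
  ultimately show ?thesis unfolding m_def by blast
qed

subsection \<open>Embeddings\<close>

text \<open>The isomorphic copy inside \<open>G\<close> is the image of \<open>H\<close> under
  \<open>f\<close>; arcs are vertex pairs, so they are mapped by
  \<open>map_prod f f\<close>.\<close>

lemma subgraph_up_to_isoI:
  assumes H: "pair_wf_digraph H" and G: "pair_wf_digraph G"
    and f: "inj_on f (pverts H)" "f ` pverts H \<subseteq> pverts G"
    and arcs: "\<And>u v. (u, v) \<in> parcs H \<Longrightarrow> (f u, f v) \<in> parcs G"
  shows "subgraph_up_to_iso H G"
proof -
  interpret H: pair_wf_digraph H by fact
  interpret G: pair_wf_digraph G by fact
  define hom where "hom = \<lparr>iso_verts = f, iso_arcs = map_prod f f, iso_head = snd, iso_tail = fst\<rparr>"
  have "inj_on (map_prod f f) (parcs H)"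
    using map_prod_inj_on[OF f(1) f(1)]
    by (rule inj_on_subset) (auto dest: H.in_arcsD1 H.in_arcsD2)
  then have iso: "H.digraph_isomorphism hom"
    using f H.wf_digraph_axioms by (auto simp: H.digraph_isomorphism_def hom_def)
  have "wf_digraph (app_iso hom (with_proj H))" by (rule H.wf_digraphI_app_iso[OF iso])
  then have "subgraph (app_iso hom (with_proj H)) (with_proj G)"
    using f arcs G.wf_digraph_axioms
    by (auto simp: subgraph_def compatible_def hom_def)
  then show ?thesis using iso unfolding subgraph_up_to_iso_def digraph_iso_def by blast
qed

text \<open>Every arc of the path changes the vertex number by one.\<close>

lemma path_awalk_length:
  assumes "pcas u p v" "set p \<subseteq> parcs (path_graph n)"
  shows "u \<le> v + length p \<and> v \<le> u + length p"
  using assms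
proof (induction p arbitrary: u)
  case (Cons e p)
  then have "snd e \<le> v + length p \<and> v \<le> snd e + length p" by auto
  then show ?case using Cons.prems by (auto simp: path_graph_def)
qed auto

lemma path_graph_distance_le_2:
  assumes "graph_distance (path_graph n) u v \<le> 2"
  shows "u \<le> v + 2 \<and> v \<le> u + 2"
proof -
  interpret P: pair_wf_digraph "path_graph n"
    by unfold_locales (auto simp: path_graph_def)
  \<comment> \<open>The distance is an infimum; weakening \<open>\<le> 2\<close> to
    \<open>< 3\<close> yields an actual walk, whose integer length is again at most 2.\<close>
  have "(INF p\<in>{p. P.awalk u p v}. ereal (P.awalk_cost (\<lambda>_. 1) p)) < ereal 3"
    using assms unfolding graph_distance_def P.\<mu>_def
    by (rule le_less_trans) simp
  then obtain p where p: "P.awalk u p v" "P.awalk_cost (\<lambda>_. 1) p < 3"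
    by (auto simp: INF_less_iff)
  then have "length p \<le> 2" by (simp add: P.awalk_cost_def sum_list_triv)
  moreover have "pcas u p v" "set p \<subseteq> parcs (path_graph n)" using p(1) by (auto simp: P.awalk_def)
  ultimately show ?thesis using path_awalk_length by fastforce
qed

text \<open>Each vertex is sent to its position in \<open>xs\<close>, so embedding \<open>G\<close>
  amounts to choosing an ordering.\<close>

lemma subgraph_up_to_iso_of_list:
  assumes G: "pair_wf_digraph G" and H: "pair_wf_digraph H"
    and xs: "distinct xs" "set xs = pverts G" and V: "pverts H = {..<length xs}"
    and arcs: "\<And>i j. \<lbrakk>i < length xs; j < length xs; (xs ! i, xs ! j) \<in> parcs G\<rbrakk> \<Longrightarrow> (i, j) \<in> parcs H"
  shows "subgraph_up_to_iso G H"
proof -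
  let ?f = "inv_into {..<length xs} ((!) xs)"
  have bij: "bij_betw ((!) xs) {..<length xs} (pverts G)"
    using bij_betw_nth[OF xs(1)] xs(2) by simp
  have fbij: "bij_betw ?f (pverts G) {..<length xs}" by (rule bij_betw_inv_into[OF bij])
  have f: "?f u < length xs" "xs ! ?f u = u" if "u \<in> pverts G" for u
    using bij_betwE[OF fbij] bij_betw_inv_into_right[OF bij] that by auto
  show ?thesis
  proof (rule subgraph_up_to_isoI[OF G H, of ?f])
    show "inj_on ?f (pverts G)" "?f ` pverts G \<subseteq> pverts H"
      using fbij by (auto simp: bij_betw_def V)
    fix u v assume uv: "(u, v) \<in> parcs G"
    then have "u \<in> pverts G" "v \<in> pverts G"
      using G by (auto dest: pair_wf_digraph.in_arcsD1 pair_wf_digraph.in_arcsD2)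
    then show "(?f u, ?f v) \<in> parcs H" using f uv by (intro arcs) auto
  qed
qed

lemma square_path_subgraph:
  assumes G: "pair_graph G" and n: "card (pverts G) = n"
    and "spreadable (pverts G) (pverts G \<times> pverts G - Id - parcs G)"
  shows "subgraph_up_to_iso (graph_square (path_graph n)) G"
proof -
  let ?R = "pverts G \<times> pverts G - Id - parcs G"
  interpret pair_graph G by fact
  have "simple_rel (pverts G) (parcs G)" by (rule pair_graph_simple_rel[OF G])
  then have sym: "sym (parcs G)" by (simp add: simple_rel_def)
  obtain xs where xs: "distinct xs" "set xs = pverts G" "spread ?R xs"
    using assms(3) by (auto simp: spreadable_def)
  have len: "length xs = n" using distinct_card[OF xs(1)] xs(2) n by simp
  have close: "(xs ! i, xs ! j) \<in> parcs G \<and> (xs ! j, xs ! i) \<in> parcs G"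
    if "i < j" "j \<le> i + 2" "j < n" for i j
  proof -
    have "(xs ! i, xs ! j) \<notin> ?R" using spread_nth[OF xs(3)] that len by simp
    moreover have "xs ! i \<in> pverts G" "xs ! j \<in> pverts G" using that len xs(2) nth_mem by force+
    moreover have "xs ! i \<noteq> xs ! j" using that len xs(1) by (simp add: nth_eq_iff_index_eq)
    ultimately show ?thesis using sym by (auto dest: symD)
  qed
  show ?thesis
  proof (rule subgraph_up_to_isoI[of _ _ "(!) xs"])
    show "pair_wf_digraph (graph_square (path_graph n))"
      by unfold_locales (auto simp: graph_square_def)
    show "pair_wf_digraph G" by unfold_locales
    show "inj_on ((!) xs) (pverts (graph_square (path_graph n)))"
      using xs(1) len by (auto simp: graph_square_def path_graph_def inj_on_def nth_eq_iff_index_eq)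
    show "(!) xs ` pverts (graph_square (path_graph n)) \<subseteq> pverts G"
      unfolding xs(2)[symmetric] len[symmetric] by (auto simp: graph_square_def path_graph_def)
    fix i j assume "(i, j) \<in> parcs (graph_square (path_graph n))"
    then have ij: "i < n" "j < n" "i \<noteq> j" "i \<le> j + 2 \<and> j \<le> i + 2"
      using path_graph_distance_le_2[of n i j] by (auto simp: graph_square_def path_graph_def)
    show "(xs ! i, xs ! j) \<in> parcs G"
    proof (cases "i < j")
      case True
      then show ?thesis using close[of i j] ij by blast
    next
      case False
      then have "j < i" using ij(3) by simp
      then show ?thesis using close[of j i] ij by blast
    qed
  qed
qed

text \<open>In the target the star has centre 0 and leaves up to \<open>n - 2\<close>, so vertex 0
  keeps only the neighbour \<open>n - 1\<close>. Hence \<open>v\<close> is listed first and its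
  possible neighbour last.\<close>

lemma low_degree_subgraph:
  assumes G: "pair_graph G" and n: "card (pverts G) = n" "2 \<le> n"
    and v: "v \<in> pverts G" "card (parcs G `` {v}) \<le> 1"
  shows "subgraph_up_to_iso G (complete_minus n (star_graph (n - 1)))"
proof -
  interpret pair_graph G by fact
  let ?V = "pverts G"
  have S: "simple_rel ?V (parcs G)" by (rule pair_graph_simple_rel[OF G])
  have "\<exists>u\<in>?V - {v}. parcs G `` {v} \<subseteq> {u}"
  proof (cases "parcs G `` {v} = {}")
    case True
    have "card (?V - {v}) \<noteq> 0" using n v pair_finite_verts by simp
    then have "?V - {v} \<noteq> {}" by force
    then show ?thesis using True by blast
  next
    case False
    then have "card (parcs G `` {v}) \<noteq> 0" using finite_Image_simple_rel[OF S] by simp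
    then have "card (parcs G `` {v}) = 1" using v by linarith
    then obtain u where u: "parcs G `` {v} = {u}" by (auto simp: card_1_singleton_iff)
    then have "u \<in> ?V" "u \<noteq> v" using S by (auto simp: simple_rel_def irrefl_def)
    then show ?thesis using u by blast
  qed
  then obtain u where u: "u \<in> ?V" "u \<noteq> v" "parcs G `` {v} \<subseteq> {u}" by blast
  have "finite (?V - {v, u})" using pair_finite_verts by simp
  from finite_distinct_list[OF this]
  obtain ws where ws: "set ws = ?V - {v, u}" "distinct ws" by (elim exE conjE)
  let ?xs = "v # ws @ [u]"
  have xs: "distinct ?xs" "set ?xs = ?V" using ws u v by auto
  have len: "length ?xs = n" using distinct_card[OF xs(1)] xs(2) n by simp
  have key: "j = n - 1" if "j < n" "(?xs ! 0, ?xs ! j) \<in> parcs G" for j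
  proof -
    have "?xs ! j = u" using that(2) u(3) by auto
    also have "u = ?xs ! (n - 1)" unfolding len[symmetric] by simp
    finally show ?thesis using nth_eq_iff_index_eq[OF xs(1), of j "n - 1"] that(1) n(2) unfolding len
      by simp
  qed
  show ?thesis
  proof (rule subgraph_up_to_iso_of_list[OF _ _ xs])
    show "pair_wf_digraph G" by unfold_locales
    show "pair_wf_digraph (complete_minus n (star_graph (n - 1)))"
      by unfold_locales (auto simp: complete_minus_def complete_graph_def)
    show "pverts (complete_minus n (star_graph (n - 1))) = {..<length ?xs}"
      using len by (simp add: complete_minus_def complete_graph_def)
    fix i j assume ij: "i < length ?xs" "j < length ?xs" "(?xs ! i, ?xs ! j) \<in> parcs G"
    have "i \<noteq> j" using ij(3) S by (auto simp: simple_rel_def irrefl_def)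
    moreover have "(?xs ! j, ?xs ! i) \<in> parcs G" using ij(3) S by (auto simp: simple_rel_def dest: symD)
    moreover have "j = n - 1" if "i = 0" using key[of j] ij(2,3) unfolding that len by blast
    moreover have "i = n - 1" if "j = 0" using key[of i] ij(1) calculation(2) unfolding that len by blast
    ultimately show "(i, j) \<in> parcs (complete_minus n (star_graph (n - 1)))"
      using ij(1,2) unfolding len
      by (auto simp: complete_minus_def complete_graph_def star_graph_def)
  qed
qed

text \<open>The deleted triangle sits on 0, 1, 2, so the independent triple is listed first.\<close>

lemma independent_triple_subgraph:
  assumes G: "pair_graph G" and n: "card (pverts G) = n"
    and T: "T \<subseteq> pverts G" "card T = 3" "parcs G \<inter> T \<times> T = {}"
  shows "subgraph_up_to_iso G (complete_minus n (complete_graph 3))"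
proof -
  interpret pair_graph G by fact
  let ?V = "pverts G"
  have S: "simple_rel ?V (parcs G)" by (rule pair_graph_simple_rel[OF G])
  have "finite T" "finite (?V - T)" using T pair_finite_verts finite_subset by auto
  then obtain ts ws where ts: "distinct ts" "set ts = T" and ws: "distinct ws" "set ws = ?V - T"
    by (meson finite_distinct_list)
  let ?xs = "ts @ ws"
  have xs: "distinct ?xs" "set ?xs = ?V" using ws ts T by auto
  have len: "length ?xs = n" using distinct_card[OF xs(1)] xs(2) n by simp
  have l3: "length ts = 3" using distinct_card[OF ts(1)] ts(2) T by simp
  then have T3: "?xs ! i \<in> T" if "i < 3" for i
    using that ts(2) nth_mem[of i ts] by (simp add: nth_append)
  show ?thesis
  proof (rule subgraph_up_to_iso_of_list[OF _ _ xs])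
    show "pair_wf_digraph G" by unfold_locales
    show "pair_wf_digraph (complete_minus n (complete_graph 3))"
      by unfold_locales (auto simp: complete_minus_def complete_graph_def)
    show "pverts (complete_minus n (complete_graph 3)) = {..<length ?xs}"
      using len by (simp add: complete_minus_def complete_graph_def)
    fix i j assume ij: "i < length ?xs" "j < length ?xs" "(?xs ! i, ?xs ! j) \<in> parcs G"
    have "i \<noteq> j" using ij(3) S by (auto simp: simple_rel_def irrefl_def)
    moreover have "\<not> (i < 3 \<and> j < 3)" using T3 ij(3) T(3) by blast
    ultimately show "(i, j) \<in> parcs (complete_minus n (complete_graph 3))"
      using ij len by (auto simp: complete_minus_def complete_graph_def)
  qed
qed

section \<open>Edges of the complement\<close>

lemma card_complement_neighbours:
  assumes "simple_rel V E" "v \<in> V"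
  shows "card (E `` {v}) + card ((V \<times> V - Id - E) `` {v}) = card V - 1"
proof -
  have "E `` {v} \<union> (V \<times> V - Id - E) `` {v} = V - {v}"
    using assms by (auto simp: simple_rel_def irrefl_def)
  moreover have "finite (E `` {v})" "finite ((V \<times> V - Id - E) `` {v})"
    using assms by (auto simp: simple_rel_def intro: finite_subset[of _ V])
  moreover have "E `` {v} \<inter> (V \<times> V - Id - E) `` {v} = {}" by auto
  ultimately have "card (E `` {v}) + card ((V \<times> V - Id - E) `` {v}) = card (V - {v})"
    using card_Un_disjoint by metis
  then show ?thesis using assms by (simp add: simple_rel_def)
qed

lemma simple_rel_complement:
  "simple_rel V E \<Longrightarrow> simple_rel V (V \<times> V - Id - E)"
  unfolding simple_rel_def sym_def irrefl_def by auto

lemma card_complement: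
  assumes "simple_rel V E"
  shows "card E + card (V \<times> V - Id - E) = card V * (card V - 1)"
proof -
  have "card E + card (V \<times> V - Id - E)
      = (\<Sum>v\<in>V. card (E `` {v}) + card ((V \<times> V - Id - E) `` {v}))"
    by (simp add: sum.distrib sum_degrees[OF assms] sum_degrees[OF simple_rel_complement[OF assms]])
  also have "\<dots> = (\<Sum>v\<in>V. card V - 1)"
    by (intro sum.cong refl card_complement_neighbours[OF assms])
  finally show ?thesis by simp
qed

text \<open>Let \<open>d\<close> be the degree of \<open>u\<close>. The neighbours of
  \<open>u\<close> have degree sum above \<open>(n-2)(n-3) + d\<close>, \<open>u\<close> adds
  \<open>d\<close>, and the other \<open>n-1-d\<close> vertices add at least 2 each, so
  \<open>d\<close> cancels. The complement has fewer than \<open>2n - 4\<close> arcs, and by parity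
  at most \<open>2n - 6\<close>.\<close>

lemma complement_card_bound:
  assumes E: "simple_rel V E" and n: "card V = n" "2 \<le> n"
    and deg: "\<And>v. v \<in> V \<Longrightarrow> 2 \<le> card (E `` {v})"
    and u: "u \<in> V" "(real n - 2) * (real n - 2 - 1) < (\<Sum>w\<in>E `` {u}. real (card (E `` {w})) - 1)"
  shows "card (V \<times> V - Id - E) + 6 \<le> 2 * n"
proof -
  let ?d = "\<lambda>w. real (card (E `` {w}))"
  let ?N = "E `` {u}"
  have fin: "finite V" and N: "?N \<subseteq> V - {u}" using E by (auto simp: simple_rel_def irrefl_def)
  have fN: "finite ?N" using fin N finite_subset by blast
  have cN: "card (V - {u} - ?N) = n - 1 - card ?N"
    using card_Diff_subset[OF fN N] fin u n by simp
  have le: "card ?N \<le> n - 1" using card_mono[OF _ N] fin u n by simp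
  have "real (card E) = (\<Sum>v\<in>V. ?d v)" using sum_degrees[OF E] by simp
  also have "\<dots> = ?d u + (\<Sum>v\<in>V - {u}. ?d v)" using fin u(1) by (rule sum.remove)
  also have "(\<Sum>v\<in>V - {u}. ?d v) = (\<Sum>v\<in>V - {u} - ?N. ?d v) + (\<Sum>v\<in>?N. ?d v)"
    using fin by (intro sum.subset_diff[OF N]) auto
  finally have cE: "real (card E) = ?d u + (\<Sum>v\<in>V - {u} - ?N. ?d v) + (\<Sum>v\<in>?N. ?d v)" by simp
  have "real (card (V - {u} - ?N)) * 2 \<le> (\<Sum>v\<in>V - {u} - ?N. ?d v)"
    by (intro sum_bounded_below) (use deg in force)
  then have "2 * (real n - 1 - ?d u) \<le> (\<Sum>v\<in>V - {u} - ?N. ?d v)"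
    using cN le n by simp
  moreover have "(\<Sum>w\<in>?N. ?d w - 1) = (\<Sum>w\<in>?N. ?d w) - ?d u" by (simp add: sum_subtractf)
  ultimately have "(real n - 2) * (real n - 2 - 1) + 2 * (real n - 1) < real (card E)"
    using cE u(2) by simp
  moreover have "real (card E) + real (card (V \<times> V - Id - E)) = real n * (real n - 1)"
  proof -
    have "real (card E + card (V \<times> V - Id - E)) = real (n * (n - 1))"
      unfolding card_complement[OF E] n(1) ..
    then show ?thesis using n(2) by (simp add: of_nat_diff)
  qed
  ultimately have "real (card (V \<times> V - Id - E)) < 2 * real n - 4" by (simp add: algebra_simps)
  then have "card (V \<times> V - Id - E) + 4 < 2 * n" by linarith
  moreover have "even (card (V \<times> V - Id - E))"
    by (rule even_card_simple_rel[OF simple_rel_complement[OF E]])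
  ultimately show ?thesis by presburger
qed

text \<open>Vertices of \<open>T\<close> have degree 5, the others degree 8. The shift 4 makes all
  row sums equal: \<open>5 * 4\<close> for \<open>u\<close> in \<open>T\<close>, and
  \<open>4 * 1 + 4 * 4\<close> otherwise. Shift 1 would not do: a vertex outside \<open>T\<close>
  then gives 44, above the threshold 42.\<close>

lemma clique_removed_degree_sum:
  assumes E: "simple_rel V E" and n: "card V = 9" and T: "T \<subseteq> V" "card T = 4"
    and R: "V \<times> V - Id - E = T \<times> T - Id" and u: "u \<in> V"
  shows "(\<Sum>w\<in>E `` {u}. real (card (E `` {w})) - 4) = 20"
proof -
  have fin: "finite V" "finite T" using E T finite_subset by (auto simp: simple_rel_def)
  have "E = V \<times> V - Id - (T \<times> T - Id)" using R E by (auto simp: simple_rel_def irrefl_def)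
  then have N: "E `` {v} = (if v \<in> T then V - T else V - {v})" if "v \<in> V" for v
    using that T by auto
  have cVT: "card (V - T) = 5" using card_Diff_subset[OF fin(2) T(1)] n T by simp
  have d: "real (card (E `` {v})) - 4 = (if v \<in> T then 1 else 4)" if "v \<in> V" for v
    using that fin n cVT by (simp add: N)
  have sum: "(\<Sum>w\<in>E `` {u}. real (card (E `` {w})) - 4) = (\<Sum>w\<in>E `` {u}. if w \<in> T then 1 else 4)"
    by (intro sum.cong refl d) (use E in \<open>auto simp: simple_rel_def\<close>)
  show ?thesis
  proof (cases "u \<in> T")
    case True
    then have "(\<Sum>w\<in>E `` {u}. if w \<in> T then 1 else 4 :: real) = (\<Sum>w\<in>V - T. 4)"
      unfolding N[OF u] by (intro sum.cong) auto
    then show ?thesis using sum cVT by simp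
  next
    case False
    have "E `` {u} = T \<union> (V - T - {u})" using T(1) N[OF u] False by auto
    then have "(\<Sum>w\<in>E `` {u}. if w \<in> T then 1 else 4 :: real)
        = (\<Sum>w\<in>T. if w \<in> T then 1 else 4) + (\<Sum>w\<in>V - T - {u}. if w \<in> T then 1 else 4)"
      using fin by (simp only:) (rule sum.union_disjoint, auto)
    also have "\<dots> = (\<Sum>w\<in>T. 1) + (\<Sum>w\<in>V - T - {u}. 4)"
      by (intro arg_cong2[where f = "(+)"] sum.cong) auto
    also have "\<dots> = 20" using T cVT False u fin by simp
    finally show ?thesis using sum by simp
  qed
qed

theorem theorem1p5:
  fixes G :: "'a pair_pre_digraph" and n :: nat
  assumes "pair_graph G"
    and "card (pverts G) = n"
    and "n \<ge> 6"
    and "graph_spectral_radius G > real n - 2"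
  shows "(n = 6 \<longrightarrow>
            subgraph_up_to_iso (graph_square (path_graph 6)) G
          \<or> subgraph_up_to_iso G (complete_minus 6 (star_graph 5))
          \<or> subgraph_up_to_iso G (complete_minus 6 (complete_graph 3)))
       \<and> (n \<ge> 7 \<longrightarrow>
            subgraph_up_to_iso (graph_square (path_graph n)) G
          \<or> subgraph_up_to_iso G (complete_minus n (star_graph (n - 1))))"
\<comment> \<open>A vertex of degree at most 1 gives the star exception for every \<open>n\<close>;
  otherwise all degrees are at least 2, as the count of complement edges requires.\<close>
proof (cases "\<exists>v\<in>pverts G. card (parcs G `` {v}) \<le> 1")
  case True
  then have "subgraph_up_to_iso G (complete_minus n (star_graph (n - 1)))"
    using low_degree_subgraph[OF assms(1,2)] assms(3) by fastforce
  then show ?thesis by auto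
next
  case False
  let ?V = "pverts G" and ?E = "parcs G"
  let ?R = "?V \<times> ?V - Id - ?E"
  interpret pair_graph G by fact
  have S: "simple_rel ?V ?E" by (rule pair_graph_simple_rel[OF assms(1)])
  have "?V \<noteq> {}" using assms(2,3) by auto
  then obtain f v where f: "\<And>v. v \<in> ?V \<Longrightarrow> (\<Sum>w\<in>?E `` {v}. f w) = graph_spectral_radius G * f v"
    and v: "v \<in> ?V" "f v \<noteq> 0"
    using spectral_radius_eigenfunction[OF S] by blast
  have large: "\<exists>u\<in>?V. (real n - 2) * (real n - 2 - c) < (\<Sum>w\<in>?E `` {u}. real (card (?E `` {w})) - c)"
    if "0 \<le> c" "c \<le> real n - 2" for c
    using exists_large_shifted_degree_sum[OF _ _ _ f v that assms(4)] S by (simp add: simple_rel_def)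
  obtain u where u: "u \<in> ?V"
    "(real n - 2) * (real n - 2 - 1) < (\<Sum>w\<in>?E `` {u}. real (card (?E `` {w})) - 1)"
    using large[of 1] assms(3) by auto
  have "card ?R + 6 \<le> 2 * n"
    using complement_card_bound[OF S assms(2) _ _ u] False assms(3) by force
  then consider "spreadable ?V ?R" | "critical_clique ?V ?R"
    using spreadable_or_critical[OF simple_rel_complement[OF S]] assms(2) by blast
  then show ?thesis
  proof cases
    case 1
    then have "subgraph_up_to_iso (graph_square (path_graph n)) G"
      by (rule square_path_subgraph[OF assms(1,2)])
    then show ?thesis by auto
  next
    case 2
    then obtain T where T: "T \<subseteq> ?V" "?R = T \<times> T - Id"
      and c: "n = 6 \<and> card T = 3 \<or> n = 9 \<and> card T = 4"
      using assms(2) by (auto simp: critical_clique_def)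
    from c show ?thesis
    proof
      assume n6: "n = 6 \<and> card T = 3"
      have "irrefl ?E" using S by (simp add: simple_rel_def)
      then have "?E \<inter> T \<times> T = {}" using T by (auto simp: irrefl_def)
      then show ?thesis using independent_triple_subgraph[OF assms(1,2) T(1)] n6 by simp
    next
      assume n9: "n = 9 \<and> card T = 4"
      \<comment> \<open>The threshold is \<open>(9 - 2)(9 - 2 - 4) = 21\<close>, while every such
        sum equals 20.\<close>
      then obtain u where "u \<in> ?V" "21 < (\<Sum>w\<in>?E `` {u}. real (card (?E `` {w})) - 4)"
        using large[of 4] by auto
      then show ?thesis using clique_removed_degree_sum[OF S _ T(1) _ T(2)] n9 assms(2) by force
    qed
  qed
qed

end
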